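(* Let $k\ge 1$ and $n\ge k+2$ be integers, and let $PP=(P,L)$ with $P=\{p_1,\dots,p_n\}$, $x(p_1)<\cdots<x(p_n)$, be a $k$-intersecting pseudoconfiguration of points in general position. Then the map $\chi_{PP}:[n]^{k+2}\to\{+1,-1,0\}$ defines a degree-$k$ uniform oriented matroid; that is, $\chi_{PP}$ is a chirotope of rank $k+2$ and $([n],\{\chi_{PP},-\chi_{PP}\})$ is a degree-$k$ uniform oriented matroid.
   Context: **Notation.** $[n]=\{1,\dots,n\}$ with its usual order. For a finite ordered set $S$ and a positive integer $r$, $\Lambda(S,r)=\{(\lambda_1,\dots,\lambda_r)\in S^r : \lambda_1<\cdots<\lambda_r\}$. For $\lambda\in\Lambda(S,r)$, $\bar\lambda=\{\lambda_1,\dots,\lambda_r\}$, and $\lambda\setminus\{\lambda_i\}$ is $\lambda$ with the entry $\lambda_i$ deleted. $x(p)$ is the $x$-coordinate of a point $p\in\mathbb{R}^2$. **Oriented matroids.** For a finite set $E$, a map $\chi:E^r\to\{+1,-1,0\}$ is a chirotope of rank $r$ if (B1) $\chi$ is not identically zero; (B2) $\chi(i_{\sigma(1)},\dots,i_{\sigma(r)})=\mathrm{sgn}(\sigma)\chi(i_1,\dots,i_r)$ for all $i_1,\dots,i_r\in E$ and all permutations $\sigma$ of $[r]$; (B3) for all $\lambda,\mu\in E^r$, the set $\{-\chi(\lambda)\chi(\mu)\}\cup\{\chi(\lambda[\lambda_1|\mu_s])\,\chi(\mu[\mu_s|\lambda_1]) : s=1,\dots,r\}$ either contains $\{+1,-1\}$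 or equals $\{0\}$, where $\lambda[\lambda_i|a]$ is $\lambda$ with its $i$-th entry replaced by $a$. The pair $(E,\{\chi,-\chi\})$ is then an oriented matroid of rank $r$; it is uniform if $\chi(\lambda)\ne 0$ for all $\lambda\in\Lambda(E,r)$ (for some, equivalently any, linear order on $E$). **Degree-$k$ uniform oriented matroids.** Let $E$ be a finite ordered set. A uniform oriented matroid $(E,\{\chi,-\chi\})$ of rank $k+2$ is a degree-$k$ uniform oriented matroid if for every $\lambda\in\Lambda(E,k+3)$ and all $a<b<c$ in $\bar\lambda$, setting $\mu_1=\lambda\setminus\{c\}$, $\mu_2=\lambda\setminus\{b\}$, $\mu_3=\lambda\setminus\{a\}$ (so $\mu_1<\mu_2<\mu_3$ lexicographically), one has: if $\chi(\mu_1)=-\chi(\mu_2)$, then $\chi(\mu_3)=\chi(\mu_2)$. **$k$-intersecting pseudoconfigurations of points.** An $x$-monotone Jordan curve is a set $l=\{(x,f(x)):x\in\mathbb{R}\}$ with $f:\mathbb{R}\to\mathbb{R}$ continuous; put $l^+=\{(x,y):y>f(x)\}$ and $l^-=\{(x,y):y<f(x)\}$. A pair $PP=(P,L)$ of a point set $P=\{p_1,\dots,p_n\}\subset\mathbb{R}^2$ with $x(p_1)<\cdots<x(p_n)$ and a collection $L$ of $x$-monotone Jordan curves is a $k$-intersecting pseudoconfiguration of points if: (PP1) every $l\in L$ contains at least $k+1$ points of $P$; (PP2) for any $k+1$ points of $P$ there is a unique $l\in L$ passing through all of them; (PP3) any two distinct $l_1,l_2\in L$ intersect at most $k$ times, each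 intersection being transversal (at each common point the two curves exchange their above-below order). It is in general position if $|P\cap l|=k+1$ for all $l\in L$; then $l_{i_1,\dots,i_{k+1}}$ denotes the curve of $L$ through $p_{i_1},\dots,p_{i_{k+1}}$. **The map $\chi_{PP}$.** For $PP$ in general position, $\chi_{PP}:[n]^{k+2}\to\{+1,-1,0\}$ is the (well-defined) map such that: for $\lambda_1<\cdots<\lambda_{k+1}$ and $\lambda_{k+2}\notin\{\lambda_1,\dots,\lambda_{k+1}\}$, $\chi_{PP}(\lambda_1,\dots,\lambda_{k+2})=+1$ if $p_{\lambda_{k+2}}\in l^+_{\lambda_1,\dots,\lambda_{k+1}}$ and $-1$ if $p_{\lambda_{k+2}}\in l^-_{\lambda_1,\dots,\lambda_{k+1}}$; $\chi_{PP}$ is $0$ on tuples with a repeated entry; and $\chi_{PP}(\lambda_{\sigma(1)},\dots,\lambda_{\sigma(k+2)})=\mathrm{sgn}(\sigma)\chi_{PP}(\lambda_1,\dots,\lambda_{k+2})$ for every permutation $\sigma$ of $[k+2]$. *)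

theory Defs
  imports Complex_Main "HOL-Combinatorics.Permutations"
begin

text \<open>
  An element of $E^r$ is a list of length \<open>r\<close> with entries in \<open>E\<close>; positions are counted
  from \<open>0\<close>.  A map on $E^r$ is represented by a total function on lists that is \<open>0\<close> outside
  $E^r$, so that equal maps are equal functions and \<open>- \<chi>\<close> is again such a map.
\<close>

definition tuples :: "'a set \<Rightarrow> nat \<Rightarrow> 'a list set" where
  "tuples E r = {xs. length xs = r \<and> set xs \<subseteq> E}"

definition Lam :: "'a::linorder set \<Rightarrow> nat \<Rightarrow> 'a list set" where
  "Lam S r = {xs \<in> tuples S r. sorted_wrt (<) xs}"

definition sign_map :: "'a set \<Rightarrow> nat \<Rightarrow> ('a list \<Rightarrow> int) \<Rightarrow> bool" where
  "sign_map E r \<chi> \<longleftrightarrow>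
     (\<forall>xs \<in> tuples E r. \<chi> xs \<in> {1, - 1, 0}) \<and> (\<forall>xs. xs \<notin> tuples E r \<longrightarrow> \<chi> xs = 0)"

definition alternating :: "'a set \<Rightarrow> nat \<Rightarrow> ('a list \<Rightarrow> int) \<Rightarrow> bool" where
  "alternating E r \<chi> \<longleftrightarrow>
     (\<forall>xs \<in> tuples E r. \<forall>\<sigma>. \<sigma> permutes {..<r} \<longrightarrow> \<chi> (permute_list \<sigma> xs) = sign \<sigma> * \<chi> xs)"

definition exchange_set :: "nat \<Rightarrow> ('a list \<Rightarrow> int) \<Rightarrow> 'a list \<Rightarrow> 'a list \<Rightarrow> int set" where
  "exchange_set r \<chi> xs ys =
     {- \<chi> xs * \<chi> ys} \<union> {\<chi> (xs[0 := ys ! s]) * \<chi> (ys[s := xs ! 0]) | s. s < r}"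

definition chirotope :: "'a set \<Rightarrow> nat \<Rightarrow> ('a list \<Rightarrow> int) \<Rightarrow> bool" where
  "chirotope E r \<chi> \<longleftrightarrow>
     finite E \<and> sign_map E r \<chi> \<and>
     (\<exists>xs \<in> tuples E r. \<chi> xs \<noteq> 0) \<and>
     alternating E r \<chi> \<and>
     (\<forall>xs \<in> tuples E r. \<forall>ys \<in> tuples E r.
        {1, - 1} \<subseteq> exchange_set r \<chi> xs ys \<or> exchange_set r \<chi> xs ys = {0})"

definition oriented_matroid :: "nat \<Rightarrow> 'a set \<times> ('a list \<Rightarrow> int) set \<Rightarrow> bool" where
  "oriented_matroid r M \<longleftrightarrow> (\<exists>\<chi>. chirotope (fst M) r \<chi> \<and> snd M = {\<chi>, - \<chi>})"

definition uniform_oriented_matroid ::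
    "nat \<Rightarrow> 'a::linorder set \<times> ('a list \<Rightarrow> int) set \<Rightarrow> bool" where
  "uniform_oriented_matroid r M \<longleftrightarrow>
     oriented_matroid r M \<and> (\<forall>\<chi> \<in> snd M. \<forall>xs \<in> Lam (fst M) r. \<chi> xs \<noteq> 0)"

text \<open>
  The condition below is invariant under \<open>\<chi> \<mapsto> - \<chi>\<close>, so asking it of both elements of
  \<open>{\<chi>, - \<chi>}\<close> is the same as asking it of one of them.
\<close>

definition degree_uniform_oriented_matroid ::
    "nat \<Rightarrow> 'a::linorder set \<times> ('a list \<Rightarrow> int) set \<Rightarrow> bool" where
  "degree_uniform_oriented_matroid k M \<longleftrightarrow>
     uniform_oriented_matroid (k + 2) M \<and>
     (\<forall>\<chi> \<in> snd M. \<forall>xs \<in> Lam (fst M) (k + 3).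
        \<forall>a \<in> set xs. \<forall>b \<in> set xs. \<forall>c \<in> set xs. a < b \<and> b < c \<longrightarrow>
          (let \<mu>\<^sub>1 = remove1 c xs; \<mu>\<^sub>2 = remove1 b xs; \<mu>\<^sub>3 = remove1 a xs
           in \<chi> \<mu>\<^sub>1 = - \<chi> \<mu>\<^sub>2 \<longrightarrow> \<chi> \<mu>\<^sub>3 = \<chi> \<mu>\<^sub>2))"

definition x_monotone_curve :: "(real \<times> real) set \<Rightarrow> bool" where
  "x_monotone_curve l \<longleftrightarrow> (\<exists>f. continuous_on UNIV f \<and> l = {(x, f x) | x. x \<in> UNIV})"

text \<open>The function of which an \<open>x\<close>-monotone curve is the graph.\<close>

definition curve_fun :: "(real \<times> real) set \<Rightarrow> real \<Rightarrow> real" where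
  "curve_fun l x = (THE y. (x, y) \<in> l)"

definition above :: "(real \<times> real) set \<Rightarrow> (real \<times> real) set" where
  "above l = {(x, y). y > curve_fun l x}"

definition below :: "(real \<times> real) set \<Rightarrow> (real \<times> real) set" where
  "below l = {(x, y). y < curve_fun l x}"

definition crosses_at :: "(real \<times> real) set \<Rightarrow> (real \<times> real) set \<Rightarrow> real \<Rightarrow> bool" where
  "crosses_at l l' x \<longleftrightarrow>
     (\<forall>\<^sub>F t in at_left x. curve_fun l t < curve_fun l' t) \<and>
     (\<forall>\<^sub>F t in at_right x. curve_fun l' t < curve_fun l t)"

definition transversal_at :: "(real \<times> real) set \<Rightarrow> (real \<times> real) set \<Rightarrow> real \<Rightarrow> bool" where
  "transversal_at l l' x \<longleftrightarrow> crosses_at l l' x \<or> crosses_at l' l x"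

text \<open>The point set is \<open>P = p ` {1..n}\<close>, labelled by increasing \<open>x\<close>-coordinate.\<close>

definition pseudoconfiguration ::
    "nat \<Rightarrow> nat \<Rightarrow> (nat \<Rightarrow> real \<times> real) \<Rightarrow> (real \<times> real) set set \<Rightarrow> bool" where
  "pseudoconfiguration k n p L \<longleftrightarrow>
     (let P = p ` {1..n} in
       (\<forall>i \<in> {1..n}. \<forall>j \<in> {1..n}. i < j \<longrightarrow> fst (p i) < fst (p j)) \<and>
       (\<forall>l \<in> L. x_monotone_curve l) \<and>
       (\<forall>l \<in> L. card (P \<inter> l) \<ge> k + 1) \<and>
       (\<forall>S \<subseteq> P. card S = k + 1 \<longrightarrow> (\<exists>!l. l \<in> L \<and> S \<subseteq> l)) \<and>
       (\<forall>l \<in> L. \<forall>l' \<in> L. l \<noteq> l' \<longrightarrow>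
          finite (l \<inter> l') \<and> card (l \<inter> l') \<le> k \<and>
          (\<forall>q \<in> l \<inter> l'. transversal_at l l' (fst q))))"

definition general_position ::
    "nat \<Rightarrow> nat \<Rightarrow> (nat \<Rightarrow> real \<times> real) \<Rightarrow> (real \<times> real) set set \<Rightarrow> bool" where
  "general_position k n p L \<longleftrightarrow> (\<forall>l \<in> L. card (p ` {1..n} \<inter> l) = k + 1)"

definition curve_through ::
    "(nat \<Rightarrow> real \<times> real) \<Rightarrow> (real \<times> real) set set \<Rightarrow> nat list \<Rightarrow> (real \<times> real) set" where
  "curve_through p L xs = (THE l. l \<in> L \<and> p ` set xs \<subseteq> l)"

definition is_chi_PP ::
    "nat \<Rightarrow> nat \<Rightarrow> (nat \<Rightarrow> real \<times> real) \<Rightarrow> (real \<times> real) set set \<Rightarrow> (nat list \<Rightarrow> int) \<Rightarrow> bool" where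
  "is_chi_PP k n p L \<chi> \<longleftrightarrow>
     sign_map {1..n} (k + 2) \<chi> \<and>
     (\<forall>xs \<in> Lam {1..n} (k + 1). \<forall>j \<in> {1..n} - set xs.
        (p j \<in> above (curve_through p L xs) \<longrightarrow> \<chi> (xs @ [j]) = 1) \<and>
        (p j \<in> below (curve_through p L xs) \<longrightarrow> \<chi> (xs @ [j]) = - 1)) \<and>
     (\<forall>xs \<in> tuples {1..n} (k + 2). \<not> distinct xs \<longrightarrow> \<chi> xs = 0) \<and>
     alternating {1..n} (k + 2) \<chi>"

text \<open>
  For a pseudoconfiguration in general position exactly one map satisfies \<open>is_chi_PP\<close>;
  that is the well-definedness of $\chi_{PP}$.
\<close>

definition chi_PP ::
    "nat \<Rightarrow> nat \<Rightarrow> (nat \<Rightarrow> real \<times> real) \<Rightarrow> (real \<times> real) set set \<Rightarrow> nat list \<Rightarrow> int" where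
  "chi_PP k n p L = (THE \<chi>. is_chi_PP k n p L \<chi>)"

end

theory Submission
  imports Defs
begin

text \<open>
  The curves through \<open>D \<union> {a}\<close> and \<open>D \<union> {b}\<close>, where \<open>D\<close> is a set of \<open>k\<close> labels, cross exactly at the
  points of \<open>D\<close>.  Up to the number of points of \<open>D\<close> on the right, their order at \<open>p b\<close> is therefore
  their order at the far right of the plane.  Hence $\chi_{PP}$ is well defined, and since the curves
  through \<open>D\<close> and one more point are linearly ordered at the far right, the signs obtained by
  deleting one element of a set of size \<open>k + 3\<close> change at most once: $\chi_{PP}$ is a signotope.

  Every signotope is a chirotope.  Axiom (B3) says that the circuit on a set \<open>W\<close> of size \<open>r + 1\<close> is
  orthogonal to the cocircuit vanishing on a set \<open>X\<close> of size \<open>r - 1\<close>.  This goes by induction on the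
  size of \<open>X - W\<close>, using that the dual of a restriction to \<open>r + 2\<close> elements has rank 2, where the
  three-term relations make a suitable tournament transitive.
\<close>

subsection \<open>Inversion signs\<close>

text \<open>Equal arguments give 1, so a product over a set that contains the point itself ignores
  that point; \<open>exchange_sign\<close> relies on this for w in W.\<close>

definition ord_sign :: "'a::linorder \<Rightarrow> 'a \<Rightarrow> int" where
  "ord_sign x y = (if y < x then - 1 else 1)"

lemma ord_sign_same [simp]: "ord_sign x x = 1"
  by (simp add: ord_sign_def)

lemma ord_sign_swap: "x \<noteq> y \<Longrightarrow> ord_sign y x = - ord_sign x y"
  by (auto simp: ord_sign_def)

lemma ord_sign_mult_self [simp]:
  "ord_sign x y * ord_sign x y = 1" "ord_sign x y * (ord_sign x y * z) = z"
  by (auto simp: ord_sign_def)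

text \<open>The parity of the rank of w in A: minus one to the number of elements of A below
  w.\<close>

definition rank_sign :: "'a::linorder set \<Rightarrow> 'a \<Rightarrow> int" where
  "rank_sign A w = (\<Prod>z\<in>A. ord_sign w z)"

lemma rank_sign_empty [simp]: "rank_sign {} w = 1"
  by (simp add: rank_sign_def)

lemma rank_sign_insert:
  "finite A \<Longrightarrow> x \<notin> A \<Longrightarrow> rank_sign (insert x A) w = ord_sign w x * rank_sign A w"
  by (simp add: rank_sign_def)

lemma rank_sign_Un:
  "finite A \<Longrightarrow> finite B \<Longrightarrow> A \<inter> B = {} \<Longrightarrow> rank_sign (A \<union> B) w = rank_sign A w * rank_sign B w"
  by (simp add: rank_sign_def prod.union_disjoint)

lemma rank_sign_cases: "rank_sign A w = 1 \<or> rank_sign A w = - 1"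
  unfolding rank_sign_def
  by (induction A rule: infinite_finite_induct) (auto simp: ord_sign_def)

lemma rank_sign_mult_self [simp]:
  "rank_sign A w * rank_sign A w = 1" "rank_sign A w * (rank_sign A w * z) = z"
  using rank_sign_cases[of A w] by auto

lemma rank_sign_remove:
  assumes "finite A" "x \<in> A"
  shows "rank_sign (A - {x}) w = ord_sign w x * rank_sign A w"
  using rank_sign_insert[of "A - {x}" x w] assms by (simp add: insert_absorb)

lemma prod_ord_sign_swap:
  assumes "y \<notin> A"
  shows "(\<Prod>z\<in>A. ord_sign z y) = (- 1) ^ card A * rank_sign A y"
proof -
  have "(\<Prod>z\<in>A. ord_sign z y) = (\<Prod>z\<in>A. - 1 * ord_sign y z)"
    using assms by (intro prod.cong) (auto simp: ord_sign_def)
  then show ?thesis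
    by (simp only: prod.distrib prod_constant rank_sign_def)
qed

text \<open>On distinct lists this is the sign of the sorting permutation.\<close>

primrec inv_sign :: "'a::linorder list \<Rightarrow> int" where
  "inv_sign [] = 1"
| "inv_sign (x # xs) = rank_sign (set xs) x * inv_sign xs"

lemma inv_sign_cases: "inv_sign xs = 1 \<or> inv_sign xs = - 1"
proof (induction xs)
  case (Cons x xs)
  then show ?case using rank_sign_cases[of "set xs" x] by auto
qed simp

lemma inv_sign_append:
  "distinct (xs @ ys) \<Longrightarrow>
     inv_sign (xs @ ys) = inv_sign xs * inv_sign ys * (\<Prod>x\<in>set xs. rank_sign (set ys) x)"
  by (induction xs) (auto simp: rank_sign_Un algebra_simps)

lemma inv_sign_sorted: "sorted_wrt (<) xs \<Longrightarrow> inv_sign xs = 1"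
proof (induction xs)
  case (Cons x xs)
  then have "rank_sign (set xs) x = 1"
    unfolding rank_sign_def by (intro prod.neutral) (auto simp: ord_sign_def)
  with Cons show ?case by simp
qed simp

lemma inv_sign_snoc:
  assumes "distinct xs" "y \<notin> set xs"
  shows "inv_sign (xs @ [y]) = inv_sign xs * (\<Prod>z\<in>set xs. ord_sign z y)"
  using assms by (simp add: inv_sign_append rank_sign_def)

text \<open>Moving y to the front passes each entry of xs once and flips one inversion each time; at
  the front, y contributes its rank among all the other entries.\<close>

lemma inv_sign_insert:
  assumes "distinct (xs @ y # ys)"
  shows "inv_sign (xs @ y # ys) =
    (- 1) ^ length xs * inv_sign (xs @ ys) * rank_sign (set xs \<union> set ys) y"
proof -
  have "(\<Prod>x\<in>set xs. rank_sign (set (y # ys)) x) =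
      (\<Prod>x\<in>set xs. ord_sign x y) * (\<Prod>x\<in>set xs. rank_sign (set ys) x)"
    using assms by (simp add: rank_sign_insert prod.distrib)
  also have "(\<Prod>x\<in>set xs. ord_sign x y) = (- 1) ^ length xs * rank_sign (set xs) y"
    using assms by (subst prod_ord_sign_swap) (auto simp: distinct_card)
  finally show ?thesis
    using assms by (simp add: inv_sign_append rank_sign_Un algebra_simps)
qed

text \<open>Both lists arise by inserting one entry at the same place of the same shorter list.
  Enlarging the two rank sets from the common entries to those stated adds the factors
  \<open>ord_sign x y\<close> and \<open>ord_sign y x\<close>, whose product is the minus
  sign.\<close>

lemma inv_sign_update:
  assumes "distinct ys" "i < length ys" "x \<notin> set ys"
  shows "inv_sign (ys[i := x]) =
    - inv_sign ys * rank_sign (set ys) x * rank_sign (insert x (set ys)) (ys ! i)"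
proof -
  define as where "as = take i ys"
  define bs where "bs = drop (Suc i) ys"
  define y where "y = ys ! i"
  have ys: "ys = as @ y # bs"
    using assms unfolding as_def bs_def y_def by (simp add: id_take_nth_drop)
  have upd: "ys[i := x] = as @ x # bs"
    using assms unfolding as_def bs_def by (simp add: upd_conv_take_nth_drop)
  have d: "distinct (as @ y # bs)" "distinct (as @ x # bs)"
    using assms ys by auto
  have xy: "x \<noteq> y" using assms ys by auto
  define M where "M = set as \<union> set bs"
  have M: "finite M" "x \<notin> M" "y \<notin> M" "set ys = insert y M"
    using assms ys d by (auto simp: M_def)
  have "rank_sign (set ys) x = ord_sign x y * rank_sign M x"
    using M by (simp add: rank_sign_insert)
  moreover have "rank_sign (insert x (set ys)) y = ord_sign y x * rank_sign M y"
    using M xy by (simp add: rank_sign_insert)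
  moreover have "inv_sign ys = (- 1) ^ length as * inv_sign (as @ bs) * rank_sign M y"
    using d inv_sign_insert[of as y bs] ys by (simp add: M_def)
  moreover have "inv_sign (ys[i := x]) = (- 1) ^ length as * inv_sign (as @ bs) * rank_sign M x"
    using d inv_sign_insert[of as x bs] upd by (simp add: M_def)
  ultimately show ?thesis
    using ord_sign_swap[OF xy] by (simp add: y_def[symmetric] algebra_simps)
qed

section \<open>Inversion signs under permutations\<close>

lemma permute_list_transpose:
  assumes "i < length xs" "j < length xs"
  shows "permute_list (Transposition.transpose i j) xs = xs[i := xs ! j, j := xs ! i]"
  using assms by (intro nth_equalityI)
    (auto simp: permute_list_def nth_list_update Transposition.transpose_def)

lemma inv_sign_transpose_less:
  assumes "distinct xs" "i < j" "j < length xs"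
  shows "inv_sign (permute_list (Transposition.transpose i j) xs) = - inv_sign xs"
proof -
  define as where "as = take i xs"
  define bs where "bs = take (j - Suc i) (drop (Suc i) xs)"
  define cs where "cs = drop (Suc j) xs"
  define x where "x = xs ! i"
  define y where "y = xs ! j"
  have l: "length as = i" "length bs = j - Suc i" using assms by (auto simp: as_def bs_def)
  have "drop (Suc i) xs = bs @ y # cs"
    unfolding bs_def y_def cs_def using assms
    using id_take_nth_drop[of "j - Suc i" "drop (Suc i) xs"] by simp
  then have xs: "xs = as @ x # bs @ y # cs"
    using assms id_take_nth_drop[of i xs] by (simp add: as_def x_def)
  have perm: "permute_list (Transposition.transpose i j) xs = as @ y # bs @ x # cs"
  proof -
    have "permute_list (Transposition.transpose i j) xs = xs[i := y, j := x]"
      using assms by (simp add: permute_list_transpose x_def y_def)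
    also have "\<dots> = (as @ y # bs @ y # cs)[j := x]"
      by (subst xs) (simp add: list_update_append l)
    also have "\<dots> = as @ y # bs @ x # cs"
    proof -
      have j: "j = length (as @ y # bs)"
        using assms l by simp
      show ?thesis
        unfolding j using list_update_length[of "as @ y # bs" y cs x] by simp
    qed
    finally show ?thesis .
  qed
  have d: "distinct (as @ x # bs @ y # cs)" using assms(1) xs by simp
  define K where "K = (- 1::int) ^ length as * (- 1) ^ length (as @ bs) * inv_sign (as @ bs @ cs)"
  define M where "M = set as \<union> set bs \<union> set cs"
  have M: "finite M" "x \<notin> M" "y \<notin> M" "x \<noteq> y" using d by (auto simp: M_def)
  \<comment> \<open>Inserting u and v into the remaining entries gives an expression symmetric in u
    and v except for \<open>ord_sign u v\<close>; this factor alone changes sign under the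
    transposition.\<close>
  have *: "inv_sign (as @ u # bs @ v # cs) = K * ord_sign u v * rank_sign M u * rank_sign M v"
    if "distinct (as @ u # bs @ v # cs)" for u v
  proof -
    have "inv_sign (as @ u # bs @ v # cs) =
        (- 1) ^ length as * inv_sign (as @ bs @ v # cs) * rank_sign (insert v M) u"
      using inv_sign_insert[OF that] by (simp add: M_def Un_assoc)
    moreover have "inv_sign (as @ bs @ v # cs) =
        (- 1) ^ length (as @ bs) * inv_sign (as @ bs @ cs) * rank_sign M v"
      using that inv_sign_insert[of "as @ bs" v cs] by (simp add: M_def Un_assoc)
    moreover have "rank_sign (insert v M) u = ord_sign u v * rank_sign M u"
      using that by (subst rank_sign_insert) (auto simp: M_def)
    ultimately show ?thesis by (simp add: K_def)
  qed
  have "distinct (as @ y # bs @ x # cs)" using d by auto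
  from *[OF this] *[OF d] show ?thesis
    using ord_sign_swap[OF M(4)] perm xs by simp
qed

lemma inv_sign_transpose:
  assumes "distinct xs" "i \<noteq> j" "i < length xs" "j < length xs"
  shows "inv_sign (permute_list (Transposition.transpose i j) xs) = - inv_sign xs"
  using inv_sign_transpose_less[of xs i j] inv_sign_transpose_less[of xs j i] assms
  by (metis transpose_commute linorder_neqE_nat)

lemma inv_sign_permute_list:
  assumes "\<sigma> permutes {..<length xs}" "distinct xs"
  shows "inv_sign (permute_list \<sigma> xs) = sign \<sigma> * inv_sign xs"
proof -
  \<comment> \<open>The claim is generalised to all lists of this length, since the induction
    hypothesis is applied to the transposed list.\<close>
  define n where "n = length xs"
  have "\<sigma> permutes {..<n}" using assms by (simp add: n_def)
  then have "\<forall>xs. length xs = n \<longrightarrow> distinct xs \<longrightarrow>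
      inv_sign (permute_list \<sigma> xs) = sign \<sigma> * inv_sign (xs :: 'a list)"
    using finite_lessThan
  proof (induction rule: permutes_induct)
    case id
    then show ?case by simp
  next
    case (swap a b p)
    let ?t = "Transposition.transpose a b"
    have t: "?t permutes {..<n}"
      using swap.hyps by (simp add: permutes_swap_id)
    have perms: "permutation p" "permutation ?t"
      using swap.hyps t by (auto simp: permutation_permutes)
    show ?case
    proof (intro allI impI)
      fix xs :: "'a list" assume xs: "length xs = n" "distinct xs"
      have "inv_sign (permute_list (?t \<circ> p) xs) = inv_sign (permute_list p (permute_list ?t xs))"
        using swap.hyps xs by (simp add: permute_list_compose)
      also have "\<dots> = sign p * inv_sign (permute_list ?t xs)"
        using swap.IH xs t by simp
      also have "inv_sign (permute_list ?t xs) = - inv_sign xs"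
        using swap.hyps xs by (intro inv_sign_transpose) auto
      also have "sign p * - inv_sign xs = sign (?t \<circ> p) * inv_sign xs"
        using swap.hyps perms by (simp add: sign_compose sign_swap_id)
      finally show "inv_sign (permute_list (?t \<circ> p) xs) = sign (?t \<circ> p) * inv_sign xs" .
    qed
  qed
  then show ?thesis using assms by (simp add: n_def)
qed

text \<open>
  With \<open>h d b\<close> instead of \<open>h b d\<close> the three products are permuted up to a common sign by every
  permutation of the four elements, so the elements may be sorted.
\<close>

lemma three_term_relation:
  fixes g :: "'a::linorder \<Rightarrow> 'a \<Rightarrow> int"
  assumes sym: "\<And>e v. g e v = g v e"
    and cases: "\<And>e v. e \<in> {a, b, c, d} \<Longrightarrow> v \<in> {a, b, c, d} \<Longrightarrow> e \<noteq> v \<Longrightarrow> g e v = 1 \<or> g e v = - 1"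
    and mono: "\<And>e u v w. {e, u, v, w} \<subseteq> {a, b, c, d} \<Longrightarrow> e \<notin> {u, v, w} \<Longrightarrow> u < v \<Longrightarrow> v < w \<Longrightarrow>
      g e w = - g e v \<Longrightarrow> g e u = g e v"
    and distinct: "distinct [a, b, c, d]"
  defines "h \<equiv> \<lambda>e v. ord_sign v e * g e v"
  shows "\<not> (h a b * h c d = h a c * h d b \<and> h a b * h c d = h a d * h b c)"
proof -
  define S where "S = {a, b, c, d}"
  define P where "P a b c d \<longleftrightarrow> {a, b, c, d} \<subseteq> S \<and> distinct [a, b, c, d] \<and>
     h a b * h c d = h a c * h d b \<and> h a b * h c d = h a d * h b c" for a b c d
  have anti: "h v e = - h e v" if "e \<noteq> v" for e v
    using that sym ord_sign_swap[of v e] by (simp add: h_def)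
  have swaps: "P v u w z \<and> P u w v z \<and> P u v z w" if "P u v w z" for u v w z
  proof -
    have d: "{u, v, w, z} \<subseteq> S" "distinct [u, v, w, z]"
      and e: "h u v * h w z = h u w * h z v" "h u v * h w z = h u z * h v w"
      using that unfolding P_def by blast+
    have n: "h v u = - h u v" "h w u = - h u w" "h z u = - h u z" "h w v = - h v w"
      "h z v = - h v z" "h z w = - h w z"
      using d by (auto intro: anti)
    have "h v u * h w z = h v w * h z u" "h v u * h w z = h v z * h u w"
      "h u w * h v z = h u v * h z w" "h u w * h v z = h u z * h w v"
      "h u v * h z w = h u z * h w v" "h u v * h z w = h u w * h v z"
      using e unfolding n by (simp_all only: mult_minus_left mult_minus_right minus_minus mult.commute)
    moreover have "{v, u, w, z} \<subseteq> S" "{u, w, v, z} \<subseteq> S" "{u, v, z, w} \<subseteq> S"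
      "distinct [v, u, w, z]" "distinct [u, w, v, z]" "distinct [u, v, z, w]"
      using d by auto
    ultimately show ?thesis unfolding P_def by (intro conjI)
  qed
  note swap1 = swaps[THEN conjunct1] and swap2 = swaps[THEN conjunct2, THEN conjunct1]
    and swap3 = swaps[THEN conjunct2, THEN conjunct2]
  have sorted4: False if "P u v w z" "u < v" "v < w" "w < z" for u v w z
  proof -
    have S: "{u, v, w, z} \<subseteq> S" using that by (simp add: P_def)
    have h: "h u v = - g u v" "h w z = - g w z" "h u w = - g u w" "h z v = g v z" "h u z = - g u z" "h v w = - g v w"
      using that sym by (auto simp: h_def ord_sign_def)
    have eqs: "g u v * g w z = - (g u w * g v z)" "g u v * g w z = g u z * g v w"
      using that(1) unfolding P_def h by linarith+
    have lt: "u < v" "v < w" "w < z" "u < w" "u < z" "v < z"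
      using that by auto
    have sub: "{u, v, w, z} \<subseteq> {a, b, c, d}" "{v, u, w, z} \<subseteq> {a, b, c, d}"
      "{w, u, v, z} \<subseteq> {a, b, c, d}" "{z, u, v, w} \<subseteq> {a, b, c, d}"
      using S unfolding S_def by blast+
    have notin: "u \<notin> {v, w, z}" "v \<notin> {u, w, z}" "w \<notin> {u, v, z}" "z \<notin> {u, v, w}"
      using lt by auto
    \<comment> \<open>One instance of \<open>mono\<close> for each of the four elements as the fixed
      one. All assignments of signs to the six pairs are then refuted one by one.\<close>
    have m: "g u z = - g u w \<longrightarrow> g u v = g u w" "g v z = - g v w \<longrightarrow> g u v = g v w"
      "g w z = - g v w \<longrightarrow> g u w = g v w" "g w z = - g v z \<longrightarrow> g u z = g v z"
      using mono[OF sub(1) notin(1) lt(2,3)] mono[OF sub(2) notin(2) lt(4,3)]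
        mono[OF sub(3) notin(3) lt(1,6)] mono[OF sub(4) notin(4) lt(1,2)]
      unfolding sym[of v u] sym[of w u] sym[of w v] sym[of z u] sym[of z v] sym[of z w]
      by iprover+
    have c: "g u v = 1 \<or> g u v = - 1" "g u w = 1 \<or> g u w = - 1" "g u z = 1 \<or> g u z = - 1"
      "g v w = 1 \<or> g v w = - 1" "g v z = 1 \<or> g v z = - 1" "g w z = 1 \<or> g w z = - 1"
      using sub(1) lt by (intro cases; simp; fail)+
    show False
      using c eqs m by (elim disjE) simp_all
  qed
  \<comment> \<open>Insertion sort by adjacent swaps, which preserve \<open>P\<close>: here the last
    entry is moved into a sorted triple, and in \<open>sorted2\<close> the third entry into a sorted
    pair.\<close>
  have sorted3: False if P: "P u v w z" and less: "u < v" "v < w" for u v w z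
  proof -
    have "z \<noteq> u" "z \<noteq> v" "z \<noteq> w" using P by (auto simp: P_def)
    then consider "z < u" | "u < z" "z < v" | "v < z" "z < w" | "w < z" by fastforce
    then show False
    proof cases
      case 1
      show False by (rule sorted4[OF swap1[OF swap2[OF swap3[OF P]]] 1 less])
    next
      case 2
      show False by (rule sorted4[OF swap2[OF swap3[OF P]] 2 less(2)])
    next
      case 3
      show False by (rule sorted4[OF swap3[OF P] less(1) 3])
    next
      case 4
      show False by (rule sorted4[OF P less 4])
    qed
  qed
  have sorted2: False if P: "P u v w z" and less: "u < v" for u v w z
  proof -
    have "w \<noteq> u" "w \<noteq> v" using P by (auto simp: P_def)
    then consider "w < u" | "u < w" "w < v" | "v < w" by fastforce
    then show False
    proof cases
      case 1
      show False by (rule sorted3[OF swap1[OF swap2[OF P]] 1 less])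
    next
      case 2
      show False by (rule sorted3[OF swap2[OF P] 2])
    next
      case 3
      show False by (rule sorted3[OF P less 3])
    qed
  qed
  have "\<not> P a b c d"
  proof
    assume P: "P a b c d"
    then have "a < b \<or> b < a" using distinct by auto
    then show False using sorted2[OF P] sorted2[OF swap1[OF P]] by blast
  qed
  then show ?thesis using distinct by (simp add: P_def S_def)
qed

subsection \<open>Signotopes\<close>

text \<open>The signs live on sets, that is, on increasing tuples. The last assumption forbids an
  alternating triple: as the deleted element runs through Z in order, the sign changes at most
  once.\<close>

locale signotope =
  fixes E :: "'a::linorder set" and r :: nat and s :: "'a set \<Rightarrow> int"
  assumes finite_ground: "finite E"
    and s_cases: "A \<subseteq> E \<Longrightarrow> card A = r \<Longrightarrow> s A = 1 \<or> s A = - 1"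
    and monotone: "Z \<subseteq> E \<Longrightarrow> card Z = Suc r \<Longrightarrow> a \<in> Z \<Longrightarrow> b \<in> Z \<Longrightarrow> c \<in> Z \<Longrightarrow> a < b \<Longrightarrow> b < c \<Longrightarrow>
      s (Z - {c}) = - s (Z - {b}) \<Longrightarrow> s (Z - {a}) = s (Z - {b})"
begin

text \<open>
  Up to a reorientation of the ground set, \<open>pair_sign Z e v\<close> is the sign of \<open>v\<close> in the circuit
  supported on \<open>Z - {e}\<close>.
\<close>

definition pair_sign :: "'a set \<Rightarrow> 'a \<Rightarrow> 'a \<Rightarrow> int" where
  "pair_sign Z e v = ord_sign v e * s (Z - {e, v})"

lemma pair_sign_swap: "e \<noteq> v \<Longrightarrow> pair_sign Z v e = - pair_sign Z e v"
  by (simp add: pair_sign_def ord_sign_swap[of v e] insert_commute)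

context
  fixes Z assumes Z: "Z \<subseteq> E" "card Z = r + 2"
begin

lemma finite_Z: "finite Z"
  using Z finite_ground finite_subset by blast

lemma card_Diff_pair: "e \<in> Z \<Longrightarrow> v \<in> Z \<Longrightarrow> e \<noteq> v \<Longrightarrow> card (Z - {e, v}) = r"
  using Z finite_Z by (simp add: card_Diff_subset)

lemma pair_sign_cases:
  "e \<in> Z \<Longrightarrow> v \<in> Z \<Longrightarrow> e \<noteq> v \<Longrightarrow> pair_sign Z e v = 1 \<or> pair_sign Z e v = - 1"
  using s_cases[of "Z - {e, v}"] card_Diff_pair Z by (auto simp: pair_sign_def ord_sign_def)

text \<open>The three-term relation of the rank 2 dual on Z. Deleting e leaves a set of size r + 1,
  where \<open>monotone\<close> supplies the sign condition that \<open>three_term_relation\<close>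
  asks for.\<close>

lemma pair_sign_relation:
  assumes "a \<in> Z" "b \<in> Z" "c \<in> Z" "d \<in> Z" "distinct [a, b, c, d]"
  shows "\<not> (pair_sign Z a b * pair_sign Z c d = pair_sign Z a c * pair_sign Z d b \<and>
            pair_sign Z a b * pair_sign Z c d = pair_sign Z a d * pair_sign Z b c)"
  unfolding pair_sign_def
proof (rule three_term_relation[where g = "\<lambda>e v. s (Z - {e, v})"])
  fix e u v w
  assume *: "{e, u, v, w} \<subseteq> {a, b, c, d}" "e \<notin> {u, v, w}" "u < v" "v < w"
    "s (Z - {e, w}) = - s (Z - {e, v})"
  have "Z - {e} - {x} = Z - {e, x}" for x by auto
  moreover have "card (Z - {e}) = Suc r"
    using * assms Z finite_Z by auto
  ultimately show "s (Z - {e, u}) = s (Z - {e, v})"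
    using * assms Z monotone[of "Z - {e}" u v w] by auto
next
  fix e v assume ev: "e \<in> {a, b, c, d}" "v \<in> {a, b, c, d}" "e \<noteq> v"
  then have "e \<in> Z" "v \<in> Z" using assms by auto
  then show "s (Z - {e, v}) = 1 \<or> s (Z - {e, v}) = - 1"
    using Z ev(3) by (intro s_cases card_Diff_pair) auto
qed (use assms in \<open>auto simp: insert_commute\<close>)

lemma ex_extreme:
  assumes A: "A \<subseteq> Z" "A \<noteq> {}" and x: "x \<in> Z" "x \<notin> A"
  shows "\<exists>m\<in>A. \<forall>v\<in>A - {m}. pair_sign Z x v * pair_sign Z m v = - pair_sign Z x m"
proof -
  define h where "h = pair_sign Z"
  \<comment> \<open>By antisymmetry of \<open>h\<close>, \<open>R\<close> orients every pair of
    distinct elements of A in exactly one direction. Once it is known to be transitive, a minimal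
    element is the required m.\<close>
  define R where "R u v \<longleftrightarrow> u \<noteq> v \<and> h x u * h x v * h u v = - 1" for u v
  have anti: "h v u = - h u v" if "u \<noteq> v" for u v
    using pair_sign_swap[OF that] by (simp only: h_def)
  have cs: "h u v = 1 \<or> h u v = - 1" if "u \<in> insert x A" "v \<in> insert x A" "u \<noteq> v" for u v
    unfolding h_def by (rule pair_sign_cases) (use that A x in blast)+
  have "asymp_on A R"
    using anti by (auto intro!: asymp_onI simp: R_def algebra_simps)
  moreover have "transp_on A R"
  proof (rule transp_onI)
    fix u v w assume uvw: "u \<in> A" "v \<in> A" "w \<in> A" and R: "R u v" "R v w"
    have "u \<noteq> w"
      using R \<open>asymp_on A R\<close> uvw by (auto dest: asymp_onD)
    with R uvw x have d: "distinct [x, u, v, w]" by (auto simp: R_def)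
    \<comment> \<open>If \<open>R u w\<close> failed, all three products in this relation would
      equal \<open>- (h x u * h x v * h x w)\<close>.\<close>
    have "\<not> (h x u * h v w = h x v * h w u \<and> h x u * h v w = h x w * h u v)"
      unfolding h_def using d A x uvw by (intro pair_sign_relation) auto
    moreover have "h x u = 1 \<or> h x u = - 1" "h x v = 1 \<or> h x v = - 1" "h x w = 1 \<or> h x w = - 1"
       "h u v = 1 \<or> h u v = - 1" "h v w = 1 \<or> h v w = - 1" "h u w = 1 \<or> h u w = - 1"
      using cs[of x u] cs[of x v] cs[of x w] cs[of u v] cs[of v w] cs[of u w] d uvw by auto
    ultimately show "R u w"
      using R d anti[of u w] unfolding R_def by (elim disjE) simp_all
  qed
  moreover have "finite A" using A finite_Z finite_subset by blast
  ultimately obtain m where m: "m \<in> A" "\<And>v. v \<in> A \<Longrightarrow> v \<noteq> m \<Longrightarrow> \<not> R v m"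
    using Finite_Set.bex_min_element[of A R] A by auto
  have "h x v * h m v = - h x m" if v: "v \<in> A - {m}" for v
  proof -
    have "h x v = 1 \<or> h x v = - 1" "h x m = 1 \<or> h x m = - 1" "h m v = 1 \<or> h m v = - 1"
      using cs[of x v] cs[of x m] cs[of m v] v m x by auto
    then show ?thesis
      using m(2)[of v] v anti[of m v] by (elim disjE) (simp_all add: R_def)
  qed
  with m show ?thesis unfolding h_def by blast
qed

end

section \<open>Orthogonality of circuits and cocircuits\<close>

text \<open>The first two factors are, up to a sign common to all w, the entry at w of the circuit
  on W; the last two are the entry at w of the cocircuit vanishing on X.\<close>

definition exchange_sign :: "'a set \<Rightarrow> 'a set \<Rightarrow> 'a \<Rightarrow> int" where
  "exchange_sign W X w = rank_sign W w * s (W - {w}) * rank_sign X w * s (insert w X)"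

text \<open>
  Orthogonality of the circuit on \<open>W\<close> and the cocircuit vanishing on \<open>X\<close>.  If all signs agreed,
  then among the circuits on \<open>insert x W - {m}\<close> with \<open>m \<in> W - X\<close> an extreme one would again agree
  in sign with the cocircuit on its smaller common support.
\<close>

lemma exchange_sign_not_constant:
  assumes "W \<subseteq> E" "X \<subseteq> E" "card W = Suc r" "Suc (card X) = r"
  shows "\<not> (\<forall>w\<in>W - X. exchange_sign W X w = c)"
  using assms
proof (induction "card (X - W)" arbitrary: W c)
  case 0
  have fin: "finite X" "finite W" using 0 finite_ground finite_subset by blast+
  have "X \<subseteq> W" using 0 fin by simp
  then have "card (W - X) = 2" using 0 fin by (simp add: card_Diff_subset)
  then obtain a b where ab: "W - X = {a, b}" "a \<noteq> b" by (auto simp: card_2_iff)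
  then have W: "W = insert a (insert b X)" "a \<notin> X" "b \<notin> X" using \<open>X \<subseteq> W\<close> by auto
  have D: "W - {a} = insert b X" "W - {b} = insert a X" using W ab(2) by auto
  have E: "insert a X \<subseteq> E" "insert b X \<subseteq> E" using 0 W by auto
  have cards: "card (insert a X) = r" "card (insert b X) = r" using W fin 0 by auto
  have "rank_sign W a = ord_sign a b * rank_sign X a" "rank_sign W b = ord_sign b a * rank_sign X b"
    using W ab(2) fin by (auto simp: rank_sign_insert)
  \<comment> \<open>With X inside W only two elements remain, and their signs are opposite because
    \<open>ord_sign\<close> is antisymmetric on distinct elements.\<close>
  then have "exchange_sign W X a = ord_sign a b * (s (insert a X) * s (insert b X))"
      "exchange_sign W X b = - (ord_sign a b * (s (insert a X) * s (insert b X)))"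
    using ord_sign_swap[OF ab(2)] by (simp_all add: exchange_sign_def D algebra_simps)
  moreover have "ord_sign a b * (s (insert a X) * s (insert b X)) \<noteq> 0"
    using s_cases[OF E(1) cards(1)] s_cases[OF E(2) cards(2)] by (auto simp: ord_sign_def)
  ultimately show ?case unfolding ab(1) by auto
next
  case (Suc n)
  have fin: "finite X" "finite W" using Suc.prems finite_ground finite_subset by blast+
  obtain x where x: "x \<in> X" "x \<notin> W"
    using Suc.hyps(2) by (metis Diff_iff card_gt_0_iff ex_in_conv zero_less_Suc)
  define Z where "Z = insert x W"
  have Z: "Z \<subseteq> E" "card Z = r + 2" using Suc.prems x fin by (auto simp: Z_def)
  have finZ: "finite Z" using fin by (simp add: Z_def)
  \<comment> \<open>The part that does not depend on the element e deleted from Z: the circuits on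
    the sets Z - {e} differ at v only in \<open>pair_sign Z e v\<close>.\<close>
  define q where "q v = rank_sign Z v * rank_sign X v * s (insert v X)" for v
  have ex: "exchange_sign (Z - {e}) X v = q v * pair_sign Z e v" if "e \<in> Z" for e v
  proof -
    have "Z - {e} - {v} = Z - {e, v}" by auto
    then show ?thesis
      using that finZ by (simp add: exchange_sign_def q_def pair_sign_def rank_sign_remove)
  qed
  show ?case
  proof
    assume "\<forall>w\<in>W - X. exchange_sign W X w = c"
    moreover have "Z - {x} = W" using x by (auto simp: Z_def)
    ultimately have c: "q v * pair_sign Z x v = c" if "v \<in> W - X" for v
      using that ex[of x v] by (simp add: Z_def)
    have "W - X \<noteq> {}"
    proof
      assume "W - X = {}"
      then have "card W \<le> card X" using fin by (intro card_mono) auto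
      then show False using Suc.prems by simp
    qed
    then obtain m where m: "m \<in> W - X"
      "\<And>v. v \<in> W - X - {m} \<Longrightarrow> pair_sign Z x v * pair_sign Z m v = - pair_sign Z x m"
      using ex_extreme[OF Z, of "W - X" x] x by (auto simp: Z_def)
    \<comment> \<open>Trading m outside X for x in X keeps the size of W and removes x from X - W,
      which is the induction step.\<close>
    define W' where "W' = Z - {m}"
    have "X - W' = X - W - {x}" using x m by (auto simp: W'_def Z_def)
    then have "n = card (X - W')" using Suc.hyps(2) x fin by simp
    moreover have "W' \<subseteq> E" "card W' = Suc r" using Z m finZ by (auto simp: W'_def Z_def)
    ultimately have "\<not> (\<forall>w\<in>W' - X. exchange_sign W' X w = - c * pair_sign Z x m)"
      using Suc.hyps(1)[of W'] Suc.prems by blast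
    moreover have "exchange_sign W' X v = - c * pair_sign Z x m" if "v \<in> W' - X" for v
    proof -
      have v: "v \<in> W - X - {m}" using that x m by (auto simp: W'_def Z_def)
      have 1: "pair_sign Z x v * pair_sign Z x v = 1"
        using pair_sign_cases[OF Z, of x v] v x by (fastforce simp: Z_def)
      have "exchange_sign W' X v = q v * pair_sign Z m v"
        using ex[of m v] m by (simp add: W'_def Z_def)
      also have "\<dots> = q v * (pair_sign Z x v * pair_sign Z x v) * pair_sign Z m v"
        by (simp only: 1 mult_1_right)
      also have "\<dots> = c * (pair_sign Z x v * pair_sign Z m v)"
        using c[of v] v by (simp add: algebra_simps)
      finally show ?thesis using m(2)[OF v] by simp
    qed
    ultimately show False by blast
  qed
qed

lemma exchange_sign_cases:
  assumes "W \<subseteq> E" "X \<subseteq> E" "card W = Suc r" "Suc (card X) = r" "w \<in> W - X"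
  shows "exchange_sign W X w = 1 \<or> exchange_sign W X w = - 1"
proof -
  have fin: "finite X" "finite W" using assms finite_ground finite_subset by blast+
  have "s (W - {w}) = 1 \<or> s (W - {w}) = - 1" "s (insert w X) = 1 \<or> s (insert w X) = - 1"
    using s_cases[of "W - {w}"] s_cases[of "insert w X"] assms fin by auto
  then show ?thesis
    using rank_sign_cases[of W w] rank_sign_cases[of X w] unfolding exchange_sign_def
    by (elim disjE) simp_all
qed

lemma exchange_sign_both:
  assumes "W \<subseteq> E" "X \<subseteq> E" "card W = Suc r" "Suc (card X) = r"
  shows "{1, - 1} \<subseteq> exchange_sign W X ` (W - X)"
  using exchange_sign_not_constant[OF assms, of 1] exchange_sign_not_constant[OF assms, of "- 1"]
    exchange_sign_cases[OF assms] by (force simp: image_iff)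

section \<open>The chirotope of a signotope\<close>

text \<open>The alternating extension of \<open>s\<close>. The default 0 off
  \<open>tuples E r\<close> follows \<open>sign_map\<close>, so that agreement with
  \<open>chi_PP\<close> is equality of total functions.\<close>

definition sign_of_tuple :: "'a list \<Rightarrow> int" where
  "sign_of_tuple xs = (if xs \<in> tuples E r \<and> distinct xs then inv_sign xs * s (set xs) else 0)"

lemma sign_of_tuple_cases:
  assumes "xs \<in> tuples E r" "distinct xs"
  shows "sign_of_tuple xs = 1 \<or> sign_of_tuple xs = - 1"
  using assms s_cases[of "set xs"] inv_sign_cases[of xs]
  by (auto simp: sign_of_tuple_def tuples_def distinct_card)

lemma sign_of_tuple_nondistinct: "\<not> distinct xs \<Longrightarrow> sign_of_tuple xs = 0"
  by (simp add: sign_of_tuple_def)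

lemma sign_map_sign_of_tuple: "sign_map E r sign_of_tuple"
  unfolding sign_map_def using sign_of_tuple_cases
  by (auto simp: sign_of_tuple_def)

lemma alternating_sign_of_tuple: "alternating E r sign_of_tuple"
  unfolding alternating_def
  by (auto simp: sign_of_tuple_def tuples_def inv_sign_permute_list)

lemma exchange_distinct:
  assumes r: "r > 0" and xs: "x # xs \<in> tuples E r" "distinct xs" and ys: "ys \<in> tuples E r" "distinct ys"
    and x: "x \<notin> set ys"
  shows "{1, - 1} \<subseteq> exchange_set r sign_of_tuple (x # xs) ys"
proof -
  let ?W = "insert x (set ys)" and ?X = "set xs"
  \<comment> \<open>The common factor between the members of the exchange set and the values of
    \<open>exchange_sign\<close>. Its minus sign matches the one in the unexchanged product, which
    belongs to w = x.\<close>
  define \<kappa> where "\<kappa> = - inv_sign xs * inv_sign ys * rank_sign (set ys) x"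
  have len: "length ys = r" "Suc (length xs) = r" "set ys \<subseteq> E" "?X \<subseteq> E" "x \<in> E"
    using xs ys by (auto simp: tuples_def)
  have mem: "\<kappa> * exchange_sign ?W ?X w \<in> exchange_set r sign_of_tuple (x # xs) ys"
    if w: "w \<in> ?W - ?X" for w
  proof (cases "w = x")
    case True
    have "rank_sign ?W x = rank_sign (set ys) x"
      using x by (simp add: rank_sign_insert)
    then have "\<kappa> * exchange_sign ?W ?X w = - sign_of_tuple (x # xs) * sign_of_tuple ys"
      using w True xs ys x
      by (simp add: \<kappa>_def exchange_sign_def sign_of_tuple_def algebra_simps)
    then show ?thesis by (simp add: exchange_set_def)
  next
    case False
    then obtain i where i: "i < r" "ys ! i = w"
      using w len by (auto simp: in_set_conv_nth)
    have upd: "distinct (ys[i := x])" "set (ys[i := x]) = ?W - {w}"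
      using ys x i len False by (auto simp: distinct_list_update set_update_distinct)
    have "sign_of_tuple (w # xs) = inv_sign xs * rank_sign ?X w * s (insert w ?X)"
      using w len i xs by (auto simp: sign_of_tuple_def tuples_def)
    moreover have "sign_of_tuple (ys[i := x]) =
        - inv_sign ys * rank_sign (set ys) x * rank_sign ?W w * s (?W - {w})"
      using upd len ys x i by (auto simp: sign_of_tuple_def tuples_def inv_sign_update)
    ultimately have "\<kappa> * exchange_sign ?W ?X w =
        sign_of_tuple ((x # xs)[0 := ys ! i]) * sign_of_tuple (ys[i := (x # xs) ! 0])"
      using i by (simp add: \<kappa>_def exchange_sign_def algebra_simps)
    then show ?thesis using i unfolding exchange_set_def by blast
  qed
  have "{1, - 1} \<subseteq> exchange_sign ?W ?X ` (?W - ?X)"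
    using len xs ys x by (intro exchange_sign_both) (auto simp: distinct_card)
  then have both: "1 \<in> exchange_sign ?W ?X ` (?W - ?X)" "- 1 \<in> exchange_sign ?W ?X ` (?W - ?X)"
    by blast+
  obtain u where u: "1 = exchange_sign ?W ?X u" "u \<in> ?W - ?X"
    by (rule imageE[OF both(1)])
  obtain v where v: "- 1 = exchange_sign ?W ?X v" "v \<in> ?W - ?X"
    by (rule imageE[OF both(2)])
  from mem[OF u(2)] mem[OF v(2)]
  have "\<kappa> \<in> exchange_set r sign_of_tuple (x # xs) ys" "- \<kappa> \<in> exchange_set r sign_of_tuple (x # xs) ys"
    unfolding u(1)[symmetric] v(1)[symmetric] by simp_all
  moreover have "\<kappa> = 1 \<or> \<kappa> = - 1"
    using inv_sign_cases[of xs] inv_sign_cases[of ys] rank_sign_cases[of "set ys" x]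
    unfolding \<kappa>_def by (elim disjE) simp_all
  ultimately show ?thesis by auto
qed

text \<open>Orthogonality settles tuples without repetitions and with x outside ys. Otherwise a
  repeated entry makes all products vanish or yields two opposite ones.\<close>

lemma exchange_axiom:
  assumes r: "r > 0" and lam: "lam \<in> tuples E r" and ys: "ys \<in> tuples E r"
  shows "{1, - 1} \<subseteq> exchange_set r sign_of_tuple lam ys \<or> exchange_set r sign_of_tuple lam ys = {0}"
proof -
  obtain x xs where lam_eq: "lam = x # xs"
    using lam r by (cases lam) (auto simp: tuples_def)
  have len: "length ys = r" "Suc (length xs) = r" "set ys \<subseteq> E" "set xs \<subseteq> E" "x \<in> E"
    using lam ys lam_eq by (auto simp: tuples_def)
  let ?\<chi> = sign_of_tuple
  let ?S = "exchange_set r ?\<chi> (x # xs) ys"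
  have S: "?S = insert (- ?\<chi> (x # xs) * ?\<chi> ys) ((\<lambda>i. ?\<chi> (ys ! i # xs) * ?\<chi> (ys[i := x])) ` {..<r})"
    unfolding exchange_set_def by auto
  have cs: "?\<chi> zs = 0 \<or> ?\<chi> zs = 1 \<or> ?\<chi> zs = - 1" if "zs \<in> tuples E r" for zs
    using sign_map_sign_of_tuple that by (auto simp: sign_map_def)
  consider (rep) "\<not> distinct xs" | (mem) "x \<in> set ys"
    | (rep2) "x \<notin> set ys" "\<not> distinct ys" | (dist) "distinct xs" "distinct ys" "x \<notin> set ys" by blast
  then have "{1, - 1} \<subseteq> ?S \<or> ?S = {0}"
  proof cases
    case rep
    then have "?S = {0}" using r unfolding S by (auto simp: sign_of_tuple_nondistinct)
    then show ?thesis ..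
  next
    case mem
    then obtain j where j: "j < r" "ys ! j = x" using len by (auto simp: in_set_conv_nth)
    \<comment> \<open>Exchanging x with its own occurrence in ys changes nothing, so
      \<open>?t\<close> lies in the exchange set beside its negative. An exchange at an entry other
      than x makes x occur twice.\<close>
    let ?t = "?\<chi> (x # xs) * ?\<chi> ys"
    have jt: "?\<chi> (ys ! j # xs) * ?\<chi> (ys[j := x]) = ?t"
      using j by (metis list_update_id)
    have t: "?t = 0 \<or> ?t = 1 \<or> ?t = - 1"
      using cs[OF lam] cs[OF ys] lam_eq by (elim disjE) simp_all
    show ?thesis
    proof (cases "?t = 0")
      case False
      moreover have "?t \<in> ?S" unfolding S using j jt by (intro insertI2 image_eqI[of _ _ j]) auto
      moreover have "- ?t \<in> ?S" unfolding S by simp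
      ultimately show ?thesis using t by auto
    next
      case True
      have "?\<chi> (ys ! i # xs) * ?\<chi> (ys[i := x]) = 0" if i: "i < r" for i
      proof (cases "ys ! i = x")
        case True
        with \<open>?t = 0\<close> show ?thesis by (metis list_update_id)
      next
        case False
        then have "i \<noteq> j" using j by auto
        then have "ys[i := x] ! i = ys[i := x] ! j"
          using i j len by simp
        then have "\<not> distinct (ys[i := x])"
          using i j len \<open>i \<noteq> j\<close> by (metis length_list_update nth_eq_iff_index_eq)
        then show ?thesis by (simp add: sign_of_tuple_nondistinct)
      qed
      then have "?S = {0}" using True r unfolding S by auto
      then show ?thesis ..
    qed
  next
    case rep2
    then obtain i j where ij: "i < r" "j < r" "i \<noteq> j" "ys ! i = ys ! j"
      using len by (auto simp: distinct_conv_nth)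
    \<comment> \<open>Replacing one or the other of two equal entries by x gives lists that differ
      by a transposition, hence opposite products; every other exchange leaves the repetition in
      place.\<close>
    let ?T = "\<lambda>i. ?\<chi> (ys ! i # xs) * ?\<chi> (ys[i := x])"
    have other: "?T l = 0" if "l < r" "l \<noteq> i" "l \<noteq> j" for l
    proof -
      have "ys[l := x] ! i = ys[l := x] ! j"
        using ij that len by simp
      then have "\<not> distinct (ys[l := x])"
        using ij len by (metis length_list_update nth_eq_iff_index_eq)
      then show ?thesis by (simp add: sign_of_tuple_nondistinct)
    qed
    have "permute_list (Transposition.transpose i j) (ys[i := x]) = ys[j := x]"
      using ij len by (auto simp: permute_list_transpose list_eq_iff_nth_eq nth_list_update)
    moreover have "ys[i := x] \<in> tuples E r"
      using len set_update_subset_insert[of ys i x] by (auto simp: tuples_def)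
    moreover have "Transposition.transpose i j permutes {..<r}"
      using ij by (simp add: permutes_swap_id)
    ultimately have "?\<chi> (ys[j := x]) = - ?\<chi> (ys[i := x])"
      using alternating_sign_of_tuple ij unfolding alternating_def
      by (metis mult_minus1 sign_swap_id)
    then have Tj: "?T j = - ?T i" using ij by simp
    have t: "?T i = 0 \<or> ?T i = 1 \<or> ?T i = - 1"
    proof -
      have "ys ! i # xs \<in> tuples E r" using len ij by (auto simp: tuples_def)
      from cs[OF this] cs[OF \<open>ys[i := x] \<in> tuples E r\<close>] show ?thesis by (elim disjE) simp_all
    qed
    have "?T i \<in> ?S" "?T j \<in> ?S" unfolding S using ij by blast+
    show ?thesis
    proof (cases "?T i = 0")
      case True
      have "?T l = 0" if "l < r" for l using True Tj other[OF that] by (cases "l = i"; cases "l = j") auto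
      moreover have "?\<chi> ys = 0" using rep2 by (simp add: sign_of_tuple_nondistinct)
      ultimately have "?S = {0}" using r unfolding S by auto
      then show ?thesis ..
    next
      case False
      with t Tj \<open>?T i \<in> ?S\<close> \<open>?T j \<in> ?S\<close> show ?thesis by auto
    qed
  next
    case dist
    then show ?thesis using exchange_distinct[OF r] lam ys lam_eq by blast
  qed
  then show ?thesis by (simp add: lam_eq)
qed

lemma chirotope_sign_of_tuple:
  assumes "0 < r" "r \<le> card E"
  shows "chirotope E r sign_of_tuple"
proof -
  obtain A where A: "A \<subseteq> E" "card A = r" "finite A"
    using obtain_subset_with_card_n[OF assms(2)] by blast
  then have "sorted_list_of_set A \<in> tuples E r" by (simp add: tuples_def)
  moreover from this have "sign_of_tuple (sorted_list_of_set A) \<noteq> 0"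
    using sign_of_tuple_cases by fastforce
  ultimately show ?thesis
    unfolding chirotope_def
    using finite_ground sign_map_sign_of_tuple alternating_sign_of_tuple exchange_axiom[OF assms(1)]
    by blast
qed

lemma sign_of_tuple_sorted:
  assumes "xs \<in> Lam E r"
  shows "sign_of_tuple xs = s (set xs)"
  using assms by (simp add: sign_of_tuple_def Lam_def inv_sign_sorted strict_sorted_iff)

text \<open>Deleting an entry keeps a tuple increasing, so no inversion sign enters and the degree
  condition is \<open>monotone\<close> itself.\<close>

lemma degree_uniform_sign_of_tuple:
  assumes r: "r = k + 2" and "r \<le> card E"
  shows "degree_uniform_oriented_matroid k (E, {sign_of_tuple, - sign_of_tuple})"
proof -
  have "chirotope E r sign_of_tuple"
    using assms by (intro chirotope_sign_of_tuple) auto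
  then have "oriented_matroid r (E, {sign_of_tuple, - sign_of_tuple})"
    unfolding oriented_matroid_def by auto
  moreover have "sign_of_tuple xs \<noteq> 0" if "xs \<in> Lam E r" for xs
    using sign_of_tuple_cases[of xs] that by (force simp: Lam_def strict_sorted_iff)
  ultimately have "uniform_oriented_matroid r (E, {sign_of_tuple, - sign_of_tuple})"
    unfolding uniform_oriented_matroid_def by auto
  moreover have "sign_of_tuple (remove1 a xs) = sign_of_tuple (remove1 b xs)"
    if xs: "xs \<in> Lam E (k + 3)" and abc: "a \<in> set xs" "b \<in> set xs" "c \<in> set xs" "a < b" "b < c"
      and flip: "sign_of_tuple (remove1 c xs) = - sign_of_tuple (remove1 b xs)" for xs a b c
  proof -
    have sorted: "sorted_wrt (<) xs" "distinct xs" "set xs \<subseteq> E" "length xs = Suc r"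
      using xs r by (auto simp: Lam_def tuples_def strict_sorted_iff)
    have rem: "sign_of_tuple (remove1 x xs) = s (set xs - {x})" if "x \<in> set xs" for x
    proof -
      have "remove1 x xs = filter (\<lambda>y. y \<noteq> x) xs"
        using sorted by (simp add: distinct_remove1_removeAll removeAll_filter_not_eq eq_commute)
      then have "sorted_wrt (<) (remove1 x xs)"
        using sorted by (simp add: sorted_wrt_filter)
      moreover have "length (remove1 x xs) = r"
        using sorted that by (simp add: length_remove1)
      moreover have "set (remove1 x xs) = set xs - {x}"
        using sorted by simp
      ultimately show ?thesis
        using sign_of_tuple_sorted[of "remove1 x xs"] sorted by (auto simp: Lam_def tuples_def)
    qed
    show ?thesis
      using monotone[of "set xs" a b c] sorted abc flip by (simp add: rem distinct_card)
  qed
  ultimately show ?thesis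
    unfolding degree_uniform_oriented_matroid_def Let_def by (simp add: r)
qed

end

subsection \<open>Crossing curves\<close>

text \<open>
  Multiplying by \<open>\<Prod>z\<in>Z. t - z\<close> cancels the sign changes, so the sign of the product is locally
  constant on punctured neighbourhoods of all points of the line.
\<close>

lemma sign_between_crossings:
  fixes F :: "real \<Rightarrow> real"
  assumes cont: "continuous_on UNIV F" and Z: "finite Z" "\<And>t. F t = 0 \<longleftrightarrow> t \<in> Z"
    and cross: "\<And>z. z \<in> Z \<Longrightarrow>
      (\<forall>\<^sub>F t in at_left z. F t < 0) \<and> (\<forall>\<^sub>F t in at_right z. F t > 0) \<or>
      (\<forall>\<^sub>F t in at_left z. F t > 0) \<and> (\<forall>\<^sub>F t in at_right z. F t < 0)"
    and t: "t \<notin> Z" "u \<notin> Z"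
  shows "sgn (F t) * (\<Prod>z\<in>Z. sgn (t - z)) = sgn (F u) * (\<Prod>z\<in>Z. sgn (u - z))"
proof -
  define G where "G t = F t * (\<Prod>z\<in>Z. t - z)" for t
  have contG: "isCont G x" for x
    unfolding G_def using cont by (auto intro!: continuous_intros simp: continuous_on_eq_continuous_at)
  have near: "\<forall>\<^sub>F y in at x. G y > 0" if "G x > 0" for x
    using contG[of x] that by (auto simp: isCont_def intro: order_tendstoD)
  have near': "\<forall>\<^sub>F y in at x. G y < 0" if "G x < 0" for x
    using contG[of x] that by (auto simp: isCont_def intro: order_tendstoD)
  have G0: "G x \<noteq> 0" if "x \<notin> Z" for x
    using that Z by (auto simp: G_def)
  \<comment> \<open>Punctured neighbourhoods are used because \<open>G\<close> vanishes on Z. Both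
    sets are open and disjoint and together cover the connected line, so one of them is
    empty.\<close>
  define U where "U = {x. \<forall>\<^sub>F y in at x. G y > 0}"
  define V where "V = {x. \<forall>\<^sub>F y in at x. G y < 0}"
  have open_aux: "open {x. \<forall>\<^sub>F y in at x. P y}" for P :: "real \<Rightarrow> bool"
  proof (subst open_subopen, intro ballI)
    fix x assume "x \<in> {x. \<forall>\<^sub>F y in at x. P y}"
    then obtain S where S: "open S" "x \<in> S" "\<And>y. y \<in> S \<Longrightarrow> y \<noteq> x \<Longrightarrow> P y"
      by (auto simp: eventually_at_topological)
    have "\<forall>\<^sub>F w in at y. P w" if "y \<in> S" for y
    proof (cases "y = x")
      case True
      then show ?thesis using S by (auto simp: eventually_at_topological)
    next
      case False
      then show ?thesis unfolding eventually_at_topological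
        using S that by (intro exI[of _ "S - {x}"]) auto
    qed
    then show "\<exists>T. open T \<and> x \<in> T \<and> T \<subseteq> {x. \<forall>\<^sub>F y in at x. P y}"
      using S by blast
  qed
  have "x \<in> U \<union> V" for x
  proof (cases "x \<in> Z")
    case False
    then have "G x > 0 \<or> G x < 0" using G0[OF False] by linarith
    then show ?thesis using near[of x] near'[of x] by (auto simp: U_def V_def)
  next
    case True
    \<comment> \<open>Near x the factor \<open>R\<close> keeps one sign, while \<open>F y\<close>
      and \<open>y - x\<close> both change sign at x; hence \<open>G\<close> has the same sign on
      both sides.\<close>
    define R where "R t = (\<Prod>z\<in>Z - {x}. t - z)" for t
    have G: "G y = F y * (y - x) * R y" for y
      using True Z by (simp add: G_def R_def prod.remove)
    have contR: "R \<midarrow>x\<rightarrow> R x"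
      unfolding R_def by (intro tendsto_intros)
    have "R x \<noteq> 0" using Z by (auto simp: R_def)
    then consider "\<forall>\<^sub>F y in at x. R y > 0" | "\<forall>\<^sub>F y in at x. R y < 0"
      using order_tendstoD[OF contR, of 0] by linarith
    then have R: "(\<forall>\<^sub>F y in at_left x. R y > 0) \<and> (\<forall>\<^sub>F y in at_right x. R y > 0) \<or>
      (\<forall>\<^sub>F y in at_left x. R y < 0) \<and> (\<forall>\<^sub>F y in at_right x. R y < 0)"
      by cases (auto simp: eventually_at_split)
    have l: "\<forall>\<^sub>F y in at_left x. y < x" and r: "\<forall>\<^sub>F y in at_right x. x < y"
      by (auto simp: eventually_at_filter)
    have pos: "\<forall>\<^sub>F y in Fl. G y > 0"
      if "(\<forall>\<^sub>F y in Fl. F y * (y - x) > 0) \<and> (\<forall>\<^sub>F y in Fl. R y > 0) \<or>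
          (\<forall>\<^sub>F y in Fl. F y * (y - x) < 0) \<and> (\<forall>\<^sub>F y in Fl. R y < 0)" for Fl
      using that unfolding G
    proof (elim disjE conjE)
      assume "\<forall>\<^sub>F y in Fl. F y * (y - x) > 0" "\<forall>\<^sub>F y in Fl. R y > 0"
      then show "\<forall>\<^sub>F y in Fl. F y * (y - x) * R y > 0"
        by eventually_elim (rule mult_pos_pos)
    next
      assume "\<forall>\<^sub>F y in Fl. F y * (y - x) < 0" "\<forall>\<^sub>F y in Fl. R y < 0"
      then show "\<forall>\<^sub>F y in Fl. F y * (y - x) * R y > 0"
        by eventually_elim (rule mult_neg_neg)
    qed
    have neg: "\<forall>\<^sub>F y in Fl. G y < 0"
      if "(\<forall>\<^sub>F y in Fl. F y * (y - x) < 0) \<and> (\<forall>\<^sub>F y in Fl. R y > 0) \<or>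
          (\<forall>\<^sub>F y in Fl. F y * (y - x) > 0) \<and> (\<forall>\<^sub>F y in Fl. R y < 0)" for Fl
      using that unfolding G
    proof (elim disjE conjE)
      assume "\<forall>\<^sub>F y in Fl. F y * (y - x) < 0" "\<forall>\<^sub>F y in Fl. R y > 0"
      then show "\<forall>\<^sub>F y in Fl. F y * (y - x) * R y < 0"
        by eventually_elim (rule mult_neg_pos)
    next
      assume "\<forall>\<^sub>F y in Fl. F y * (y - x) > 0" "\<forall>\<^sub>F y in Fl. R y < 0"
      then show "\<forall>\<^sub>F y in Fl. F y * (y - x) * R y < 0"
        by eventually_elim (rule mult_pos_neg)
    qed
    have "(\<forall>\<^sub>F y in at_left x. F y * (y - x) > 0) \<and> (\<forall>\<^sub>F y in at_right x. F y * (y - x) > 0) \<or>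
        (\<forall>\<^sub>F y in at_left x. F y * (y - x) < 0) \<and> (\<forall>\<^sub>F y in at_right x. F y * (y - x) < 0)"
      using cross[OF True]
    proof (elim disjE conjE)
      assume a: "\<forall>\<^sub>F t in at_left x. F t < 0" "\<forall>\<^sub>F t in at_right x. F t > 0"
      have "\<forall>\<^sub>F y in at_left x. F y * (y - x) > 0"
        using a(1) l by eventually_elim (simp add: zero_less_mult_iff)
      moreover have "\<forall>\<^sub>F y in at_right x. F y * (y - x) > 0"
        using a(2) r by eventually_elim (simp add: zero_less_mult_iff)
      ultimately show ?thesis by blast
    next
      assume a: "\<forall>\<^sub>F t in at_left x. F t > 0" "\<forall>\<^sub>F t in at_right x. F t < 0"
      have "\<forall>\<^sub>F y in at_left x. F y * (y - x) < 0"
        using a(1) l by eventually_elim (simp add: mult_less_0_iff)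
      moreover have "\<forall>\<^sub>F y in at_right x. F y * (y - x) < 0"
        using a(2) r by eventually_elim (simp add: mult_less_0_iff)
      ultimately show ?thesis by blast
    qed
    with R have "(\<forall>\<^sub>F y in at_left x. G y > 0) \<and> (\<forall>\<^sub>F y in at_right x. G y > 0) \<or>
        (\<forall>\<^sub>F y in at_left x. G y < 0) \<and> (\<forall>\<^sub>F y in at_right x. G y < 0)"
      using pos neg by blast
    then show ?thesis by (auto simp: U_def V_def eventually_at_split)
  qed
  then have "UNIV \<subseteq> U \<union> V" by blast
  moreover have disj: "U \<inter> V = {}"
  proof (rule ccontr)
    assume "U \<inter> V \<noteq> {}"
    then obtain x where "\<forall>\<^sub>F y in at x. G y > 0" "\<forall>\<^sub>F y in at x. G y < 0"
      by (auto simp: U_def V_def)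
    then have "\<forall>\<^sub>F y in at x. False" by eventually_elim simp
    then show False by simp
  qed
  moreover have "open U" "open V" unfolding U_def V_def by (rule open_aux)+
  ultimately have "U = {} \<or> V = {}"
    using connectedD[OF connected_UNIV, of U V] by auto
  then have "sgn (G t) = sgn (G u)"
    using near[of t] near[of u] near'[of t] near'[of u] G0[OF t(1)] G0[OF t(2)]
    unfolding U_def V_def by (cases "G t > 0"; cases "G u > 0") (auto simp: sgn_real_def)
  moreover have "sgn (\<Prod>z\<in>A. x - z) = (\<Prod>z\<in>A. sgn (x - z))" for x and A :: "real set"
    by (induction A rule: infinite_finite_induct) (auto simp: sgn_mult)
  ultimately show ?thesis by (simp add: G_def sgn_mult)
qed

subsection \<open>Pseudoconfigurations in general position\<close>

lemma x_monotone_curve_fun: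
  assumes "x_monotone_curve l"
  shows "continuous_on UNIV (curve_fun l)" and "(x, y) \<in> l \<longleftrightarrow> y = curve_fun l x"
proof -
  obtain f where f: "continuous_on UNIV f" "l = {(x, f x) | x. x \<in> UNIV}"
    using assms by (auto simp: x_monotone_curve_def)
  have "curve_fun l = f"
    by (auto simp: curve_fun_def f(2))
  with f show "continuous_on UNIV (curve_fun l)" "(x, y) \<in> l \<longleftrightarrow> y = curve_fun l x"
    by auto
qed

locale generic_pseudoconfiguration =
  fixes k n :: nat and p :: "nat \<Rightarrow> real \<times> real" and L :: "(real \<times> real) set set"
  assumes pseudoconfiguration: "pseudoconfiguration k n p L"
    and general_position: "general_position k n p L"
begin

lemmas pseudoconfiguration_unfolded = pseudoconfiguration[unfolded pseudoconfiguration_def Let_def]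

lemma px_mono: "i \<in> {1..n} \<Longrightarrow> j \<in> {1..n} \<Longrightarrow> i < j \<Longrightarrow> fst (p i) < fst (p j)"
  using pseudoconfiguration_unfolded[THEN conjunct1] by blast

lemma monotone_curves: "l \<in> L \<Longrightarrow> x_monotone_curve l"
  using pseudoconfiguration_unfolded[THEN conjunct2, THEN conjunct1] by blast

lemma unique_curve: "S \<subseteq> p ` {1..n} \<Longrightarrow> card S = k + 1 \<Longrightarrow> \<exists>!l. l \<in> L \<and> S \<subseteq> l"
  using pseudoconfiguration_unfolded[THEN conjunct2, THEN conjunct2, THEN conjunct2, THEN conjunct1]
  by simp

lemma
  assumes "l \<in> L" "l' \<in> L" "l \<noteq> l'"
  shows finite_Int_curves: "finite (l \<inter> l')"
    and card_Int_curves: "card (l \<inter> l') \<le> k"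
    and transversal: "q \<in> l \<inter> l' \<Longrightarrow> transversal_at l l' (fst q)"
proof -
  note * = pseudoconfiguration_unfolded[THEN conjunct2, THEN conjunct2, THEN conjunct2, THEN conjunct2,
      THEN bspec, OF assms(1), THEN bspec, OF assms(2), THEN mp, OF assms(3)]
  show "finite (l \<inter> l')" by (rule *[THEN conjunct1])
  show "card (l \<inter> l') \<le> k" by (rule *[THEN conjunct2, THEN conjunct1])
  show "transversal_at l l' (fst q)" if "q \<in> l \<inter> l'"
    using that by (rule *[THEN conjunct2, THEN conjunct2, THEN bspec])
qed

lemma inj_px: "inj_on (\<lambda>i. fst (p i)) {1..n}"
  by (rule linorder_inj_onI', drule (2) px_mono) simp

lemma inj_p: "inj_on p {1..n}"
  by (rule inj_onI, rule inj_onD[OF inj_px]) simp_all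

section \<open>Curves through k + 1 points and their order at the far right\<close>

definition curve :: "nat set \<Rightarrow> (real \<times> real) set" where
  "curve S = (THE l. l \<in> L \<and> p ` S \<subseteq> l)"

lemma curve_through_eq: "curve_through p L xs = curve (set xs)"
  by (simp add: curve_through_def curve_def)

lemma
  assumes "S \<subseteq> {1..n}" "card S = k + 1"
  shows curve_in_L: "curve S \<in> L" and points_on_curve: "p ` S \<subseteq> curve S"
proof -
  have "card (p ` S) = k + 1"
    using assms inj_p by (simp add: card_image inj_on_subset)
  then have "\<exists>!l. l \<in> L \<and> p ` S \<subseteq> l"
    using assms by (intro unique_curve) auto
  from theI'[OF this] show "curve S \<in> L" "p ` S \<subseteq> curve S"
    by (auto simp: curve_def)
qed

text \<open>In general position the curve carries exactly k + 1 of the points, and those labelled by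
  S already account for all of them.\<close>

lemma on_curve_iff:
  assumes "S \<subseteq> {1..n}" "card S = k + 1" "j \<in> {1..n}"
  shows "p j \<in> curve S \<longleftrightarrow> j \<in> S"
proof
  assume j: "p j \<in> curve S"
  have "card (p ` {1..n} \<inter> curve S) = k + 1"
    using general_position curve_in_L[OF assms(1,2)] by (auto simp: general_position_def)
  moreover have "card (p ` S) = k + 1"
    using assms inj_p by (simp add: card_image inj_on_subset)
  moreover have "p ` S \<subseteq> p ` {1..n} \<inter> curve S"
    using assms points_on_curve[OF assms(1,2)] by auto
  ultimately have "p ` S = p ` {1..n} \<inter> curve S"
    by (intro card_subset_eq) auto
  with j assms show "j \<in> S"
    using inj_p by (metis IntI image_eqI inj_on_image_mem_iff)
next
  assume "j \<in> S"
  then show "p j \<in> curve S" using points_on_curve[OF assms(1,2)] by auto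
qed

abbreviation height :: "nat set \<Rightarrow> real \<Rightarrow> real" where
  "height S \<equiv> curve_fun (curve S)"

lemma height_eq_iff:
  assumes "S \<subseteq> {1..n}" "card S = k + 1" "j \<in> {1..n}"
  shows "snd (p j) = height S (fst (p j)) \<longleftrightarrow> j \<in> S"
  using x_monotone_curve_fun(2)[OF monotone_curves[OF curve_in_L[OF assms(1,2)]], of "fst (p j)" "snd (p j)"]
    on_curve_iff[OF assms] by simp

text \<open>A point on the curve would also get -1, but by \<open>height_eq_iff\<close> this happens
  only for j in S.\<close>

definition side :: "nat set \<Rightarrow> nat \<Rightarrow> int" where
  "side S j = (if height S (fst (p j)) < snd (p j) then 1 else - 1)"

text \<open>A place to the right of all the points, hence of all crossings of two curves that share
  k points.\<close>

definition far_right :: real where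
  "far_right = fst (p n) + 1"

lemma px_less_far_right: "i \<in> {1..n} \<Longrightarrow> fst (p i) < far_right"
  unfolding far_right_def using px_mono[of i n] by (cases "i = n") auto

definition far_order :: "nat set \<Rightarrow> nat \<Rightarrow> nat \<Rightarrow> int" where
  "far_order D a b = (if height (insert a D) far_right < height (insert b D) far_right then 1 else - 1)"

context
  fixes D a b
  assumes D: "D \<subseteq> {1..n}" "card D = k" and ab: "a \<in> {1..n} - D" "b \<in> {1..n} - D" "a \<noteq> b"
begin

lemma insert_in_range:
  "finite D" "insert a D \<subseteq> {1..n}" "card (insert a D) = k + 1"
  "insert b D \<subseteq> {1..n}" "card (insert b D) = k + 1"
proof -
  show f: "finite D" using D finite_subset by blast
  show "insert a D \<subseteq> {1..n}" "card (insert a D) = k + 1"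
    "insert b D \<subseteq> {1..n}" "card (insert b D) = k + 1"
    using f D ab by auto
qed

lemma curves_distinct: "curve (insert a D) \<noteq> curve (insert b D)"
  using on_curve_iff[of "insert a D" a] on_curve_iff[of "insert b D" a] insert_in_range ab by auto

text \<open>The k points of D already exhaust the number of intersections allowed to two distinct
  curves.\<close>

lemma Int_curves: "curve (insert a D) \<inter> curve (insert b D) = p ` D"
proof -
  have "p ` D \<subseteq> curve (insert a D) \<inter> curve (insert b D)"
    using points_on_curve[of "insert a D"] points_on_curve[of "insert b D"] insert_in_range by auto
  moreover have "card (p ` D) = k"
    using D inj_p by (simp add: card_image inj_on_subset)
  moreover note finite_Int_curves[OF curve_in_L curve_in_L curves_distinct]
    card_Int_curves[OF curve_in_L curve_in_L curves_distinct]
  ultimately show ?thesis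
    using insert_in_range by (metis card_seteq)
qed

lemma heights_eq_iff:
  "height (insert a D) t = height (insert b D) t \<longleftrightarrow> t \<in> (\<lambda>d. fst (p d)) ` D"
proof -
  let ?la = "curve (insert a D)" and ?lb = "curve (insert b D)"
  have mem: "(x, y) \<in> ?la \<longleftrightarrow> y = curve_fun ?la x" "(x, y) \<in> ?lb \<longleftrightarrow> y = curve_fun ?lb x" for x y
    using insert_in_range by (auto intro!: x_monotone_curve_fun monotone_curves curve_in_L)
  have "curve_fun ?la t = curve_fun ?lb t \<longleftrightarrow> (\<exists>y. (t, y) \<in> ?la \<inter> ?lb)"
    using mem by auto
  also have "\<dots> \<longleftrightarrow> (\<exists>y. (t, y) \<in> p ` D)" by (simp add: Int_curves)
  also have "\<dots> \<longleftrightarrow> t \<in> fst ` p ` D"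
    by (simp only: fst_eq_Domain Domain_iff)
  also have "fst ` p ` D = (\<lambda>d. fst (p d)) ` D" by (rule image_image)
  finally show ?thesis .
qed

lemma far_order_swap: "far_order D b a = - far_order D a b"
proof -
  have "far_right \<notin> (\<lambda>d. fst (p d)) ` D"
    using px_less_far_right D by force
  then have "height (insert a D) far_right \<noteq> height (insert b D) far_right"
    by (simp only: heights_eq_iff not_False_eq_True)
  then show ?thesis by (auto simp: far_order_def)
qed

text \<open>
  The two curves share the \<open>k\<close> points of \<open>D\<close>, hence cross at these and nowhere else; each point of
  \<open>D\<close> to the right of \<open>p b\<close> contributes one change of order.
\<close>

lemma side_eq_far_order: "side (insert a D) b = (\<Prod>d\<in>D. ord_sign d b) * far_order D a b"
proof -
  let ?la = "curve (insert a D)" and ?lb = "curve (insert b D)" and ?x = "\<lambda>i. fst (p i)"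
  \<comment> \<open>The curve of b passes through \<open>p b\<close>, so with this order of
    subtraction \<open>F\<close> has there the sign \<open>side (insert a D) b\<close>; at
    \<open>far_right\<close> its sign is \<open>far_order D a b\<close>.\<close>
  define F where "F t = curve_fun ?lb t - curve_fun ?la t" for t
  have L: "?la \<in> L" "?lb \<in> L" using insert_in_range by (auto intro!: curve_in_L)
  have inj: "inj_on ?x D" by (rule inj_on_subset[OF inj_px D(1)])
  have bD: "?x b \<notin> ?x ` D"
    using ab D by (subst inj_on_image_mem_iff[OF inj_px]) auto
  have fD: "far_right \<notin> ?x ` D"
    using px_less_far_right D by force
  have F0: "F t = 0 \<longleftrightarrow> t \<in> ?x ` D" for t
    using heights_eq_iff[of t] by (auto simp: F_def)
  have "sgn (F (?x b)) * (\<Prod>z\<in>?x ` D. sgn (?x b - z)) =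
      sgn (F far_right) * (\<Prod>z\<in>?x ` D. sgn (far_right - z))"
  proof (rule sign_between_crossings)
    show "continuous_on UNIV F"
      unfolding F_def using L by (intro continuous_intros x_monotone_curve_fun monotone_curves)
    fix z assume "z \<in> ?x ` D"
    then obtain d where "d \<in> D" "z = ?x d" by auto
    then have "transversal_at ?la ?lb z"
      using transversal[OF L curves_distinct, of "p d"] Int_curves by auto
    then show "(\<forall>\<^sub>F t in at_left z. F t < 0) \<and> (\<forall>\<^sub>F t in at_right z. F t > 0) \<or>
        (\<forall>\<^sub>F t in at_left z. F t > 0) \<and> (\<forall>\<^sub>F t in at_right z. F t < 0)"
      unfolding transversal_at_def crosses_at_def F_def by auto
  qed (use insert_in_range F0 bD fD in auto)
  moreover have "(\<Prod>z\<in>?x ` D. sgn (far_right - z)) = 1"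
    using px_less_far_right D by (intro prod.neutral) force
  moreover have "(\<Prod>z\<in>?x ` D. sgn (?x b - z)) = of_int (\<Prod>d\<in>D. ord_sign d b)"
  proof -
    have "(\<Prod>z\<in>?x ` D. sgn (?x b - z)) = (\<Prod>d\<in>D. sgn (?x b - ?x d))"
      using inj by (simp add: prod.reindex)
    also have "\<dots> = (\<Prod>d\<in>D. of_int (ord_sign d b))"
    proof (rule prod.cong)
      fix d assume d: "d \<in> D"
      then have "d < b \<or> b < d" using ab by (metis DiffD2 linorder_neqE_nat)
      then show "sgn (?x b - ?x d) = of_int (ord_sign d b)"
        using px_mono[of d b] px_mono[of b d] d D ab by (auto simp: ord_sign_def)
    qed simp
    finally show ?thesis by simp
  qed
  moreover have "snd (p b) = curve_fun ?lb (?x b)"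
    using height_eq_iff[of "insert b D" b] insert_in_range ab by auto
  then have "sgn (F (?x b)) = of_int (side (insert a D) b)"
    using F0[of "?x b"] bD by (auto simp: side_def F_def sgn_real_def)
  moreover have "sgn (F far_right) = of_int (far_order D a b)"
    using F0[of far_right] fD by (auto simp: far_order_def F_def sgn_real_def)
  ultimately have "real_of_int (side (insert a D) b * (\<Prod>d\<in>D. ord_sign d b)) = of_int (far_order D a b)"
    by simp
  then have eq: "side (insert a D) b * (\<Prod>d\<in>D. ord_sign d b) = far_order D a b"
    by (simp only: of_int_eq_iff)
  have "(\<Prod>d\<in>D. ord_sign d b) * (\<Prod>d\<in>D. ord_sign d b) = 1"
    by (simp add: prod.distrib[symmetric])
  then show ?thesis unfolding eq[symmetric]
    by (metis mult.assoc mult.commute mult.right_neutral)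
qed

end

section \<open>The signotope of a pseudoconfiguration\<close>

definition set_sign :: "nat set \<Rightarrow> int" where
  "set_sign S = side (S - {Max S}) (Max S)"

lemma side_eq_set_sign:
  assumes S: "S \<subseteq> {1..n}" "card S = k + 2" and j: "j \<in> S"
  shows "side (S - {j}) j = (\<Prod>d\<in>S - {j}. ord_sign d j) * set_sign S"
proof -
  have fin: "finite S" using S finite_subset by blast
  define M where "M = Max S"
  have M: "M \<in> S" "\<And>d. d \<in> S \<Longrightarrow> d \<le> M"
    unfolding M_def using fin j by (auto intro: Max_in)
  have neutral: "(\<Prod>d\<in>A. ord_sign d M) = 1" if "A \<subseteq> S" for A
  proof (intro prod.neutral ballI)
    fix d assume "d \<in> A"
    then have "d \<le> M" using that M by blast
    then show "ord_sign d M = 1" by (simp add: ord_sign_def)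
  qed
  show ?thesis
  proof (cases "j = M")
    case True
    then show ?thesis using neutral[of "S - {j}"] by (simp add: set_sign_def M_def)
  next
    case False
    define D where "D = S - {j, M}"
    have D: "D \<subseteq> {1..n}" "card D = k" "M \<in> {1..n} - D" "j \<in> {1..n} - D"
      using S M j False fin by (auto simp: D_def card_Diff_subset)
    have eqs: "S - {j} = insert M D" "S - {M} = insert j D"
      using M j False by (auto simp: D_def)
    have "ord_sign M j = - 1" using M(2)[OF j] False by (simp add: ord_sign_def)
    moreover have "finite D" "M \<notin> D" using fin by (auto simp: D_def)
    ultimately have "(\<Prod>d\<in>S - {j}. ord_sign d j) = - (\<Prod>d\<in>D. ord_sign d j)"
      unfolding eqs by simp
    moreover have "side (S - {j}) j = (\<Prod>d\<in>D. ord_sign d j) * far_order D M j"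
      unfolding eqs using D False by (intro side_eq_far_order) auto
    moreover have "set_sign S = far_order D j M"
      unfolding set_sign_def M_def[symmetric] eqs
      using side_eq_far_order[of D j M] D False neutral[of D] by (simp add: D_def)
    moreover have "far_order D M j = - far_order D j M"
      using D False by (intro far_order_swap) auto
    ultimately show ?thesis by simp
  qed
qed

lemma set_sign_eq_far_order:
  assumes D: "D \<subseteq> {1..n}" "card D = k" and ab: "a \<in> {1..n} - D" "b \<in> {1..n} - D" "a < b"
  shows "set_sign (insert a (insert b D)) = far_order D a b"
proof -
  have fin: "finite D" using D finite_subset by blast
  define q where "q = (\<Prod>d\<in>D. ord_sign d b)"
  have "side (insert a D) b = (\<Prod>d\<in>insert a D. ord_sign d b) * set_sign (insert a (insert b D))"
    using side_eq_set_sign[of "insert a (insert b D)" b] D ab fin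
    by (simp add: insert_commute insert_Diff_if)
  also have "(\<Prod>d\<in>insert a D. ord_sign d b) = q"
    using fin ab by (simp add: ord_sign_def q_def)
  finally have "q * set_sign (insert a (insert b D)) = q * far_order D a b"
    using side_eq_far_order[of D a b] D ab by (simp add: q_def)
  moreover have "q \<noteq> 0"
    using fin by (auto simp: q_def ord_sign_def)
  ultimately show ?thesis by simp
qed

text \<open>
  The curves through \<open>D\<close> and one further point are linearly ordered at \<open>far_right\<close>, and a forbidden
  sign pattern would be a cycle in that order.
\<close>

sublocale signotope "{1..n}" "k + 2" set_sign
proof
  fix A assume "A \<subseteq> {1..n}" "card A = k + 2"
  show "set_sign A = 1 \<or> set_sign A = - 1"
    by (simp add: set_sign_def side_def)
next
  fix Z a b c
  assume Z: "Z \<subseteq> {1..n}" "card Z = Suc (k + 2)"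
    and abc: "a \<in> Z" "b \<in> Z" "c \<in> Z" "a < b" "b < c"
    and flip: "set_sign (Z - {c}) = - set_sign (Z - {b})"
  have fin: "finite Z" using Z finite_subset by blast
  define D where "D = Z - {a, b, c}"
  have D: "D \<subseteq> {1..n}" "card D = k" "a \<in> {1..n} - D" "b \<in> {1..n} - D" "c \<in> {1..n} - D"
    using Z abc fin by (auto simp: D_def card_Diff_subset)
  have eqs: "Z - {c} = insert a (insert b D)" "Z - {b} = insert a (insert c D)"
    "Z - {a} = insert b (insert c D)"
    using abc by (auto simp: D_def)
  have "set_sign (Z - {c}) = far_order D a b"
    unfolding eqs by (rule set_sign_eq_far_order[OF D(1,2,3,4) abc(4)])
  moreover have "set_sign (Z - {b}) = far_order D a c"
    unfolding eqs by (rule set_sign_eq_far_order[OF D(1,2,3,5) less_trans[OF abc(4,5)]])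
  moreover have "set_sign (Z - {a}) = far_order D b c"
    unfolding eqs by (rule set_sign_eq_far_order[OF D(1,2,4,5) abc(5)])
  ultimately show "set_sign (Z - {a}) = set_sign (Z - {b})"
    using flip by (simp add: far_order_def split: if_splits)
qed simp

section \<open>Identification with the map of the pseudoconfiguration\<close>

text \<open>The sign of sorting j into xs and the factor in \<open>side_eq_set_sign\<close> are the
  same product, so they cancel.\<close>

lemma sign_of_tuple_snoc:
  assumes "xs \<in> Lam {1..n} (k + 1)" "j \<in> {1..n} - set xs"
  shows "sign_of_tuple (xs @ [j]) = side (set xs) j"
proof -
  have xs: "length xs = k + 1" "set xs \<subseteq> {1..n}" "sorted_wrt (<) xs" "distinct xs"
    using assms by (auto simp: Lam_def tuples_def strict_sorted_iff)
  have "side (insert j (set xs) - {j}) j =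
      (\<Prod>d\<in>insert j (set xs) - {j}. ord_sign d j) * set_sign (insert j (set xs))"
    using xs assms by (intro side_eq_set_sign) (auto simp: distinct_card)
  moreover have "insert j (set xs) - {j} = set xs" using assms by auto
  ultimately have "side (set xs) j = (\<Prod>d\<in>set xs. ord_sign d j) * set_sign (insert j (set xs))"
    by simp
  moreover have "xs @ [j] \<in> tuples {1..n} (k + 2)" "distinct (xs @ [j])"
    using xs assms by (auto simp: tuples_def)
  then have "sign_of_tuple (xs @ [j]) = inv_sign (xs @ [j]) * set_sign (set (xs @ [j]))"
    unfolding sign_of_tuple_def by argo
  ultimately show ?thesis
    using xs assms by (simp add: inv_sign_snoc inv_sign_sorted)
qed

lemma above_iff: "p j \<in> above (curve S) \<longleftrightarrow> height S (fst (p j)) < snd (p j)"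
  and below_iff: "p j \<in> below (curve S) \<longleftrightarrow> snd (p j) < height S (fst (p j))"
  by (auto simp: above_def below_def case_prod_beta)

lemma is_chi_PP_sign_of_tuple: "is_chi_PP k n p L sign_of_tuple"
  unfolding is_chi_PP_def
proof (intro conjI ballI)
  fix xs j assume "xs \<in> Lam {1..n} (k + 1)" "j \<in> {1..n} - set xs"
  then show "p j \<in> above (curve_through p L xs) \<longrightarrow> sign_of_tuple (xs @ [j]) = 1"
    "p j \<in> below (curve_through p L xs) \<longrightarrow> sign_of_tuple (xs @ [j]) = - 1"
    using sign_of_tuple_snoc[of xs j] unfolding curve_through_eq above_iff below_iff side_def by auto
qed (use sign_map_sign_of_tuple alternating_sign_of_tuple sign_of_tuple_nondistinct in auto)

text \<open>On an increasing tuple the value is prescribed, because the last point lies strictly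
  above or below the curve through the others; alternation carries it to every ordering.\<close>

lemma is_chi_PP_unique:
  assumes "is_chi_PP k n p L \<chi>" "is_chi_PP k n p L \<chi>'"
  shows "\<chi> = \<chi>'"
proof
  fix xs
  consider "xs \<notin> tuples {1..n} (k + 2)" | "xs \<in> tuples {1..n} (k + 2)" "\<not> distinct xs"
    | "xs \<in> tuples {1..n} (k + 2)" "distinct xs" by blast
  then show "\<chi> xs = \<chi>' xs"
  proof cases
    case 1
    then show ?thesis using assms by (auto simp: is_chi_PP_def sign_map_def)
  next
    case 2
    then show ?thesis using assms by (auto simp: is_chi_PP_def)
  next
    case 3
    define ys where "ys = sort xs"
    have ys: "mset ys = mset xs" "sorted_wrt (<) ys" "set ys = set xs" "length ys = k + 2" "distinct ys"
      using 3 by (auto simp: ys_def tuples_def strict_sorted_iff)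
    define zs where "zs = butlast ys"
    define j where "j = last ys"
    have "ys \<noteq> []" using ys(4) by auto
    then have snoc: "ys = zs @ [j]"
      by (simp add: zs_def j_def)
    have zs: "zs \<in> Lam {1..n} (k + 1)" and j: "j \<in> {1..n} - set zs"
      using ys 3 snoc by (auto simp: Lam_def tuples_def sorted_wrt_append)
    have "snd (p j) \<noteq> height (set zs) (fst (p j))"
      using height_eq_iff[of "set zs" j] zs j
      by (auto simp: Lam_def tuples_def strict_sorted_iff distinct_card)
    then have "p j \<in> above (curve_through p L zs) \<or> p j \<in> below (curve_through p L zs)"
      unfolding curve_through_eq above_iff below_iff by auto
    then have "\<chi> ys = \<chi>' ys"
      using assms zs j unfolding is_chi_PP_def snoc by metis
    moreover obtain \<sigma> where \<sigma>: "\<sigma> permutes {..<length ys}" "permute_list \<sigma> ys = xs"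
      using mset_eq_permutation[OF ys(1)[symmetric]] by blast
    have "ys \<in> tuples {1..n} (k + 2)" using ys 3 by (auto simp: tuples_def)
    then have "\<chi> xs = sign \<sigma> * \<chi> ys" "\<chi>' xs = sign \<sigma> * \<chi>' ys"
      using assms \<sigma> ys(4) unfolding is_chi_PP_def alternating_def by metis+
    ultimately show ?thesis by simp
  qed
qed

lemma chi_PP_eq: "chi_PP k n p L = sign_of_tuple"
  unfolding chi_PP_def
  using is_chi_PP_sign_of_tuple is_chi_PP_unique by (intro the_equality) auto

end

theorem proposition4p4:
  fixes k n :: nat
    and p :: "nat \<Rightarrow> real \<times> real"
    and L :: "(real \<times> real) set set"
  assumes "k \<ge> 1" and "n \<ge> k + 2"
    and "pseudoconfiguration k n p L"
    and "general_position k n p L"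
  shows "chirotope {1..n} (k + 2) (chi_PP k n p L) \<and>
         degree_uniform_oriented_matroid k ({1..n}, {chi_PP k n p L, - chi_PP k n p L})"
proof -
  interpret generic_pseudoconfiguration k n p L
    using assms by unfold_locales
  show ?thesis
    using assms(2) chirotope_sign_of_tuple degree_uniform_sign_of_tuple by (simp add: chi_PP_eq)
qed

end
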